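(* Let $\mathcal{M}$ be a finite set, let $\mathcal{H}$ be a two-dimensional Hilbert space, and let $\boldsymbol{\rho} \in \mathcal{E}(\mathcal{M},\mathcal{H})$ be an ensemble, bijective onto its range, whose range $\boldsymbol{\rho}(\mathcal{M})$ is proportional to (the vertex set of) a regular polygon in the Bloch circle. Then $$G_{\min}(\boldsymbol{\rho}) = \frac{|\mathcal{M}|+1}{2} - \frac12 \begin{cases} \dfrac{2\sqrt{3\cos^2\left(\frac{\pi}{|\mathcal{M}|}\right)+1}}{|\mathcal{M}|\,\sin^2\left(\frac{\pi}{|\mathcal{M}|}\right)}, & \text{if } |\mathcal{M}| \text{ is even},\\[3ex] \dfrac{\cos\left(\frac{\pi}{2|\mathcal{M}|}\right)}{|\mathcal{M}|\,\sin^2\left(\frac{\pi}{2|\mathcal{M}|}\right)}, & \text{if } |\mathcal{M}| \text{ is odd}.\end{cases}$$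
   Context: Hilbert spaces are complex. $\mathcal{L}_+(\mathcal{H})$ is the cone of positive semidefinite operators on $\mathcal{H}$, $\mathbb{1}$ the identity. For a finite set $\mathcal{M}$: - $\mathcal{N}_{\mathcal{M}}$ is the set of numberings, i.e. bijections $\mathbf{n}:\{1,\dots,|\mathcal{M}|\}\to\mathcal{M}$. - $\mathcal{E}(\mathcal{M},\mathcal{H})$ is the set of ensembles, i.e. maps $\boldsymbol{\rho}:\mathcal{M}\to\mathcal{L}_+(\mathcal{H})$ with $\sum_{m\in\mathcal{M}}\operatorname{Tr}[\boldsymbol{\rho}(m)]=1$. - $\mathcal{P}(\mathcal{N}_{\mathcal{M}},\mathcal{H})$ is the set of numbering-valued measurements, i.e. maps $\boldsymbol{\pi}:\mathcal{N}_{\mathcal{M}}\to\mathcal{L}_+(\mathcal{H})$ with $\sum_{\mathbf{n}\in\mathcal{N}_{\mathcal{M}}}\boldsymbol{\pi}(\mathbf{n})=\mathbb{1}$. The guesswork is $G(\boldsymbol{\rho},\boldsymbol{\pi}) := \sum_{t=1}^{|\mathcal{M}|} t\, q_{\boldsymbol{\rho},\boldsymbol{\pi}}(t)$, where $q_{\boldsymbol{\rho},\boldsymbol{\pi}}(t) := \sum_{\mathbf{n}\in\mathcal{N}_{\mathcal{M}}}\operatorname{Tr}[\boldsymbol{\rho}(\mathbf{n}(t))\,\boldsymbol{\pi}(\mathbf{n})]$. The minimum guesswork is $G_{\min}(\boldsymbol{\rho}) := \min_{\boldsymbol{\pi}\in\mathcal{P}(\mathcal{N}_{\mathcal{M}},\mathcal{H})}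 G(\boldsymbol{\rho},\boldsymbol{\pi})$. Bloch circle: with respect to some orthonormal basis of $\mathcal{H}$, the set of pure states $\tfrac12(\mathbb{1} + x\sigma_x + z\sigma_z)$ with $(x,z)\in\mathbb{R}^2$, $x^2+z^2=1$, where $\sigma_x,\sigma_z$ are Pauli matrices. "The range is proportional to a regular polygon in the Bloch circle" means that $\boldsymbol{\rho}(m) = |\mathcal{M}|^{-1}\cdot\tfrac12(\mathbb{1}+x_m\sigma_x+z_m\sigma_z)$ for $m\in\mathcal{M}$, where $m\mapsto(x_m,z_m)$ is a bijection from $\mathcal{M}$ onto the vertex set of a regular $|\mathcal{M}|$-gon ($|\mathcal{M}|\ge 3$) inscribed in the unit circle (the proportionality factor is $|\mathcal{M}|^{-1}$ by normalization of the ensemble). *)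

theory Defs
  imports "HOL-Analysis.Analysis"
begin

section \<open>Complex Hilbert spaces\<close>

text \<open>The inner product is antilinear in the first argument. Positive definiteness of
  \<open>cinner\<close> follows from \<open>norm_eq_sqrt_cinner\<close> and the norm axioms; completeness comes
  from \<open>banach\<close>.\<close>

class chilbert_space = banach +
  fixes scaleC :: "complex \<Rightarrow> 'a \<Rightarrow> 'a" (infixr "*\<^sub>C" 75)
    and cinner :: "'a \<Rightarrow> 'a \<Rightarrow> complex"
  assumes scaleC_add_right: "a *\<^sub>C (x + y) = a *\<^sub>C x + a *\<^sub>C y"
    and scaleC_add_left: "(a + b) *\<^sub>C x = a *\<^sub>C x + b *\<^sub>C x"
    and scaleC_scaleC: "a *\<^sub>C b *\<^sub>C x = (a * b) *\<^sub>C x"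
    and scaleR_scaleC: "r *\<^sub>R x = complex_of_real r *\<^sub>C x"
    and cinner_commute: "cinner x y = cnj (cinner y x)"
    and cinner_add_right: "cinner x (y + z) = cinner x y + cinner x z"
    and cinner_scaleC_right: "cinner x (a *\<^sub>C y) = a * cinner x y"
    and norm_eq_sqrt_cinner: "norm x = sqrt (Re (cinner x x))"

lemma scaleC_one: "1 *\<^sub>C x = (x :: 'a::chilbert_space)"
  using scaleR_scaleC[of 1 x] by simp

global_interpretation complex_vector: vector_space "scaleC :: complex \<Rightarrow> 'a \<Rightarrow> 'a::chilbert_space"
  by unfold_locales (simp_all add: scaleC_add_right scaleC_add_left scaleC_scaleC scaleC_one)

text \<open>The standard spaces \<open>complex ^ 'n\<close> are instances.\<close>

instantiation complex :: chilbert_space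
begin

definition scaleC_complex :: "complex \<Rightarrow> complex \<Rightarrow> complex"
  where "scaleC_complex a x = a * x"

definition cinner_complex :: "complex \<Rightarrow> complex \<Rightarrow> complex"
  where "cinner_complex x y = cnj x * y"

instance
  by standard
    (auto simp: scaleC_complex_def cinner_complex_def algebra_simps scaleR_conv_of_real
      cmod_def power2_eq_square)

end

instantiation vec :: (chilbert_space, finite) chilbert_space
begin

definition scaleC_vec :: "complex \<Rightarrow> 'a ^ 'b \<Rightarrow> 'a ^ 'b"
  where "scaleC_vec a x = (\<chi> i. a *\<^sub>C (x $ i))"

definition cinner_vec :: "'a ^ 'b \<Rightarrow> 'a ^ 'b \<Rightarrow> complex"
  where "cinner_vec x y = (\<Sum>i\<in>UNIV. cinner (x $ i) (y $ i))"

instance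
proof
  fix a b :: complex and r :: real and x y z :: "'a ^ 'b"
  show "a *\<^sub>C (x + y) = a *\<^sub>C x + a *\<^sub>C y"
    by (simp add: scaleC_vec_def vec_eq_iff scaleC_add_right)
  show "(a + b) *\<^sub>C x = a *\<^sub>C x + b *\<^sub>C x"
    by (simp add: scaleC_vec_def vec_eq_iff scaleC_add_left)
  show "a *\<^sub>C b *\<^sub>C x = (a * b) *\<^sub>C x"
    by (simp add: scaleC_vec_def vec_eq_iff scaleC_scaleC)
  show "r *\<^sub>R x = complex_of_real r *\<^sub>C x"
    by (simp add: scaleC_vec_def vec_eq_iff scaleR_scaleC)
  show "cinner x y = cnj (cinner y x)"
    by (simp add: cinner_vec_def flip: cinner_commute)
  show "cinner x (y + z) = cinner x y + cinner x z"
    by (simp add: cinner_vec_def cinner_add_right sum.distrib)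
  show "cinner x (a *\<^sub>C y) = a * cinner x y"
    by (simp add: cinner_vec_def scaleC_vec_def cinner_scaleC_right sum_distrib_left)
  have "(norm v)\<^sup>2 = Re (cinner v v)" for v :: 'a
    by (metis norm_eq_sqrt_cinner norm_ge_zero real_sqrt_ge_0_iff real_sqrt_pow2)
  then show "norm x = sqrt (Re (cinner x x))"
    by (simp add: norm_vec_def L2_set_def cinner_vec_def)
qed

end


section \<open>Operators\<close>

definition positive_operators :: "('h::chilbert_space \<Rightarrow> 'h) set"
  where "positive_operators =
    {A. Vector_Spaces.linear (*\<^sub>C) (*\<^sub>C) A \<and>
        (\<forall>x. cinner x (A x) \<in> \<real> \<and> 0 \<le> Re (cinner x (A x)))}"

text \<open>Spanning is algebraic, so this is the usual notion for finite-dimensional spaces only,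
  and likewise for the trace, which does not depend on the chosen basis.\<close>

definition orthonormal_basis :: "'h::chilbert_space set \<Rightarrow> bool"
  where "orthonormal_basis B \<longleftrightarrow>
    (\<forall>x\<in>B. \<forall>y\<in>B. cinner x y = (if x = y then 1 else 0)) \<and> complex_vector.span B = UNIV"

definition op_trace :: "('h::chilbert_space \<Rightarrow> 'h) \<Rightarrow> complex"
  where "op_trace A = (\<Sum>e\<in>(SOME B. orthonormal_basis B). cinner e (A e))"


section \<open>Guesswork\<close>

text \<open>Numberings are made extensional, so that each bijection is counted once in sums.\<close>

definition numberings :: "'m set \<Rightarrow> (nat \<Rightarrow> 'm) set"
  where "numberings M = {n \<in> extensional {1..card M}. bij_betw n {1..card M} M}"

definition ensembles :: "'m set \<Rightarrow> ('m \<Rightarrow> 'h::chilbert_space \<Rightarrow> 'h) set"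
  where "ensembles M =
    {\<rho>. (\<forall>m\<in>M. \<rho> m \<in> positive_operators) \<and> (\<Sum>m\<in>M. op_trace (\<rho> m)) = 1}"

definition numbering_measurements ::
    "'m set \<Rightarrow> ((nat \<Rightarrow> 'm) \<Rightarrow> 'h::chilbert_space \<Rightarrow> 'h) set"
  where "numbering_measurements M =
    {\<pi>. (\<forall>n\<in>numberings M. \<pi> n \<in> positive_operators) \<and>
        (\<forall>x. (\<Sum>n\<in>numberings M. \<pi> n x) = x)}"

text \<open>The traces below are real, being traces of products of two positive operators.\<close>

definition guess_prob ::
    "'m set \<Rightarrow> ('m \<Rightarrow> 'h::chilbert_space \<Rightarrow> 'h) \<Rightarrow> ((nat \<Rightarrow> 'm) \<Rightarrow> 'h \<Rightarrow> 'h) \<Rightarrow> nat \<Rightarrow> real"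
  where "guess_prob M \<rho> \<pi> t = (\<Sum>n\<in>numberings M. Re (op_trace (\<rho> (n t) \<circ> \<pi> n)))"

definition guesswork ::
    "'m set \<Rightarrow> ('m \<Rightarrow> 'h::chilbert_space \<Rightarrow> 'h) \<Rightarrow> ((nat \<Rightarrow> 'm) \<Rightarrow> 'h \<Rightarrow> 'h) \<Rightarrow> real"
  where "guesswork M \<rho> \<pi> = (\<Sum>t = 1..card M. real t * guess_prob M \<rho> \<pi> t)"

text \<open>An infimum; that it is a minimum has to be stated separately.\<close>

definition min_guesswork :: "'m set \<Rightarrow> ('m \<Rightarrow> 'h::chilbert_space \<Rightarrow> 'h) \<Rightarrow> real"
  where "min_guesswork M \<rho> = (INF \<pi>\<in>numbering_measurements M. guesswork M \<rho> \<pi>)"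


section \<open>Regular polygons in the Bloch circle\<close>

text \<open>Pauli operators with respect to an orthonormal basis \<open>{e0, e1}\<close>.\<close>

definition pauli_x :: "'h::chilbert_space \<Rightarrow> 'h \<Rightarrow> 'h \<Rightarrow> 'h"
  where "pauli_x e0 e1 v = cinner e1 v *\<^sub>C e0 + cinner e0 v *\<^sub>C e1"

definition pauli_z :: "'h::chilbert_space \<Rightarrow> 'h \<Rightarrow> 'h \<Rightarrow> 'h"
  where "pauli_z e0 e1 v = cinner e0 v *\<^sub>C e0 - cinner e1 v *\<^sub>C e1"

definition bloch_operator :: "'h::chilbert_space \<Rightarrow> 'h \<Rightarrow> real \<times> real \<Rightarrow> 'h \<Rightarrow> 'h"
  where "bloch_operator e0 e1 = (\<lambda>(x, z) v.
    (1/2) *\<^sub>R (v + x *\<^sub>R pauli_x e0 e1 v + z *\<^sub>R pauli_z e0 e1 v))"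

text \<open>Regular polygon with \<open>N\<close> vertices inscribed in the unit circle, rotated by \<open>\<theta>\<close>.\<close>

definition regular_polygon :: "nat \<Rightarrow> real \<Rightarrow> (real \<times> real) set"
  where "regular_polygon N \<theta> =
    (\<lambda>k. (cos (\<theta> + 2 * pi * real k / real N), sin (\<theta> + 2 * pi * real k / real N))) ` {..<N}"

definition bloch_regular_polygon :: "'m set \<Rightarrow> ('m \<Rightarrow> 'h::chilbert_space \<Rightarrow> 'h) \<Rightarrow> bool"
  where "bloch_regular_polygon M \<rho> \<longleftrightarrow> card M \<ge> 3 \<and>
    (\<exists>e0 e1 \<theta> p. e0 \<noteq> e1 \<and> orthonormal_basis {e0, e1} \<and>
      bij_betw p M (regular_polygon (card M) \<theta>) \<and>
      (\<forall>m\<in>M. \<rho> m = (\<lambda>v. (1 / real (card M)) *\<^sub>R bloch_operator e0 e1 (p m) v)))"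

end

theory Submission
  imports Defs "HOL-Number_Theory.Cong"
begin

text \<open>Writing \<open>v n\<close> for the sum of \<open>t\<close> times the Bloch vector of \<open>\<rho> (n t)\<close>, positivity of the
  measurement operators gives the lower bound \<open>(N + 1) / 2 - L / N\<close> for the guesswork, where \<open>N\<close> is
  the number of vertices and \<open>L\<close> the largest length of a \<open>v n\<close>. Reversing a numbering negates
  \<open>v n\<close>, so the projective measurement along a longest \<open>v n\<close>, with outcomes that numbering and its
  reversal, attains the bound. Four times the component of \<open>v n\<close> in a direction is at most the sum of
  all \<open>\<bar>a i - a j\<bar>\<close>, with \<open>a k\<close> the heights of the vertices in that direction, with equality if
  the numbering sorts the heights. For a regular polygon this double sum factors into sums of
  \<open>\<bar>sin\<bar>\<close> over equally spaced angles, which are explicit sinusoids on each sector and can be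
  maximised over the direction.\<close>

section \<open>Sums of absolute sines\<close>

lemma abs_sin_add_int_pi: "\<bar>sin (x + pi * of_int k)\<bar> = \<bar>sin x\<bar>"
proof -
  have s: "sin (pi * of_int k) = 0"
    by (metis mult.commute sin_times_pi_eq_0 Ints_of_int)
  then have "\<bar>cos (pi * of_int k)\<bar> = 1"
    using sin_cos_squared_add[of "pi * of_int k"] by (simp add: abs_square_eq_1)
  with s show ?thesis
    by (simp add: sin_add abs_mult)
qed

text \<open>For \<open>a\<close> coprime to \<open>N\<close> the map taking i to a i + c permutes
  the residues modulo \<open>N\<close>, so it leaves a sum over one period unchanged. It serves
  below with \<open>a\<close> equal to 1, -1 and -2.\<close>

lemma sum_periodic_affine:
  fixes F :: "int \<Rightarrow> 'a::comm_monoid_add"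
  assumes per: "\<And>i k. F (i + int N * k) = F i" and cop: "coprime a (int N)"
  shows "(\<Sum>i<N. F (a * int i + c)) = (\<Sum>i<N. F (int i))"
proof (cases "N = 0")
  case False
  have mod: "F (i mod int N) = F i" for i
    using per[of "i mod int N" "i div int N"] by (simp add: add.commute)
  define f where "f i = (a * i + c) mod int N" for i
  have "inj_on f {0..<int N}"
  proof (rule inj_onI)
    fix x y assume xy: "x \<in> {0..<int N}" "y \<in> {0..<int N}" "f x = f y"
    then have "[a * x = a * y] (mod int N)"
      unfolding f_def by (simp add: cong_def [symmetric] cong_add_rcancel)
    then have "[x = y] (mod int N)"
      using cong_mult_lcancel cop by blast
    then show "x = y"
      using xy by (simp add: cong_def)
  qed
  moreover have "f ` {0..<int N} \<subseteq> {0..<int N}"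
    using False by (auto simp: f_def)
  ultimately have "f ` {0..<int N} = {0..<int N}"
    by (intro endo_inj_surj) auto
  then have "bij_betw f {0..<int N} {0..<int N}"
    using \<open>inj_on f _\<close> by (simp add: bij_betw_def)
  then have "(\<Sum>i\<in>{0..<int N}. F (f i)) = (\<Sum>i\<in>{0..<int N}. F i)"
    by (rule sum.reindex_bij_betw)
  then have *: "(\<Sum>i\<in>{0..<int N}. F (a * i + c)) = (\<Sum>i\<in>{0..<int N}. F i)"
    by (simp add: f_def mod)
  have "bij_betw int {..<N} {0..<int N}"
    by (rule bij_betw_byWitness[where f' = nat]) auto
  from sum.reindex_bij_betw[OF this, of "\<lambda>i. F (a * i + c)"]
    sum.reindex_bij_betw[OF this, of F] * show ?thesis
    by simp
qed simp

definition abs_sin_sum :: "nat \<Rightarrow> real \<Rightarrow> real"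
  where "abs_sin_sum h x = (\<Sum>j<h. \<bar>sin (x + pi * real j / real h)\<bar>)"

text \<open>Since |sin| has period pi, moving by a multiple of the spacing pi / h only permutes the
  terms cyclically. A closed form on one sector of width pi / h is therefore enough.\<close>

lemma abs_sin_sum_shift: "abs_sin_sum h (x + pi * of_int k / real h) = abs_sin_sum h x"
proof (cases "h = 0")
  case False
  define F where "F i = \<bar>sin (x + pi * real_of_int i / real h)\<bar>" for i
  have "F (i + int h * l) = F i" for i l
    using abs_sin_add_int_pi[of "x + pi * real_of_int i / real h" l] False
    by (simp add: F_def field_simps)
  from sum_periodic_affine[of F h 1 k, OF this] show ?thesis
    by (simp add: abs_sin_sum_def F_def add_divide_distrib distrib_left ac_simps)
qed (simp add: abs_sin_sum_def)

text \<open>In this sector all the angles lie in [0, pi], so the absolute values disappear.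
  Multiplying the remaining sum by 2 sin b, with b half the spacing, makes it telescope.\<close>

lemma abs_sin_sum_eq:
  assumes "0 \<le> x" "x \<le> pi / real h" and h: "h > 0"
  shows "abs_sin_sum h x = cos (x - pi / (2 * real h)) / sin (pi / (2 * real h))"
proof -
  define b where "b = pi / (2 * real h)"
  have "b \<le> pi / 2"
    using h by (simp add: b_def field_simps)
  moreover have "0 < b" "2 * b = pi / real h"
    using h by (simp_all add: b_def)
  ultimately have b: "0 < b" "b < pi" "2 * b = pi / real h"
    using pi_gt_zero by linarith+
  then have sb: "sin b > 0"
    by (intro sin_gt_zero)
  have "\<bar>sin (x + pi * real j / real h)\<bar> = sin (x + 2 * b * real j)" if "j < h" for j
  proof -
    have "x + 2 * b * real j \<le> 2 * b + 2 * b * real j" using assms b by simp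
    also have "\<dots> = 2 * b * real (Suc j)" by (simp add: algebra_simps)
    also have "\<dots> \<le> 2 * b * real h" using that b by (intro mult_left_mono) auto
    also have "\<dots> = pi" using h by (simp add: b_def)
    finally have "sin (x + 2 * b * real j) \<ge> 0"
      using assms b by (intro sin_ge_zero) auto
    then show ?thesis using b by simp
  qed
  then have sum: "abs_sin_sum h x = (\<Sum>j<h. sin (x + 2 * b * real j))"
    unfolding abs_sin_sum_def by simp
  have "2 * sin b * (\<Sum>j<h. sin (x + 2 * b * real j)) =
      (\<Sum>j<h. cos (x - b + 2 * b * real j) - cos (x - b + 2 * b * real (Suc j)))"
    unfolding sum_distrib_left
  proof (rule sum.cong)
    fix j
    have "x - b + 2 * b * real j = (x + 2 * b * real j) - b"
      "x - b + 2 * b * real (Suc j) = (x + 2 * b * real j) + b"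
      by (simp_all add: algebra_simps)
    then show "2 * sin b * sin (x + 2 * b * real j) =
        cos (x - b + 2 * b * real j) - cos (x - b + 2 * b * real (Suc j))"
      by (simp only: cos_add cos_diff) simp
  qed simp
  also have "\<dots> = cos (x - b) - cos (x - b + 2 * b * real h)"
    by (subst sum_lessThan_telescope') simp
  also have "2 * b * real h = pi" using h by (simp add: b_def)
  finally have "2 * sin b * (\<Sum>j<h. sin (x + 2 * b * real j)) = 2 * cos (x - b)"
    by simp
  then have "sin b * abs_sin_sum h x = cos (x - b)"
    by (simp add: sum)
  then show ?thesis
    using sb by (simp add: b_def field_simps)
qed

section \<open>Heights of the vertices of a regular polygon and their pairwise differences\<close>

lemma sum_cos_regular_polygon:
  assumes "N \<ge> 2"
  shows "(\<Sum>k<N. cos (\<psi> + 2 * pi * real k / real N)) = 0"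
proof -
  define a where "a = pi / real N"
  have a: "0 < a" "a < pi"
    using assms pi_gt_zero by (auto simp: a_def field_simps)
  then have sa: "sin a > 0"
    by (intro sin_gt_zero)
  \<comment> \<open>Here \<open>a\<close> is half the vertex spacing, which again makes the sum
    telescope; its end points differ by a full turn, so the total vanishes.\<close>
  have "2 * sin a * (\<Sum>k<N. cos (\<psi> + 2 * pi * real k / real N)) =
      (\<Sum>k<N. sin (\<psi> - a + 2 * a * real (Suc k)) - sin (\<psi> - a + 2 * a * real k))"
    unfolding sum_distrib_left
  proof (rule sum.cong)
    fix k
    have "(\<psi> - a + 2 * a * real (Suc k) - (\<psi> - a + 2 * a * real k)) / 2 = a"
      "(\<psi> - a + 2 * a * real (Suc k) + (\<psi> - a + 2 * a * real k)) / 2 = \<psi> + 2 * pi * real k / real N"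
      by (simp_all add: a_def algebra_simps add_divide_distrib)
    then show "2 * sin a * cos (\<psi> + 2 * pi * real k / real N) =
        sin (\<psi> - a + 2 * a * real (Suc k)) - sin (\<psi> - a + 2 * a * real k)"
      by (simp only: sin_diff_sin)
  qed simp
  also have "\<dots> = sin (\<psi> - a + 2 * a * real N) - sin (\<psi> - a)"
    by (subst sum_lessThan_telescope) simp
  also have "2 * a * real N = 2 * pi" using assms by (simp add: a_def)
  finally show ?thesis
    using sa by (simp add: sin_add)
qed

text \<open>The angle \<open>\<psi>\<close> is that of vertex 0 relative to the chosen direction, so
  the cosines are the heights of the vertices. Ordered pairs are summed: every chord counts
  twice.\<close>

definition vertex_spread :: "nat \<Rightarrow> real \<Rightarrow> real"
  where "vertex_spread N \<psi> = (\<Sum>i<N. \<Sum>j<N.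
    \<bar>cos (\<psi> + 2 * pi * real i / real N) - cos (\<psi> + 2 * pi * real j / real N)\<bar>)"

text \<open>The chord joining vertices \<open>i\<close> and \<open>j\<close> has direction depending on \<open>i + j\<close> and length
  depending on \<open>i - j\<close>; chords are grouped by \<open>k = i + j\<close> modulo \<open>N\<close>.\<close>

lemma vertex_spread_eq:
  assumes "N > 0"
  shows "vertex_spread N \<psi> = 2 * (\<Sum>k<N. \<bar>sin (\<psi> + pi * real k / real N)\<bar> *
    (\<Sum>j<N. \<bar>sin (pi * (real k - 2 * real j) / real N)\<bar>))"
proof -
  have inner: "(\<Sum>i<N. \<bar>cos (\<psi> + 2 * pi * real i / real N) - cos (\<psi> + 2 * pi * real j / real N)\<bar>) =
      (\<Sum>k<N. 2 * (\<bar>sin (\<psi> + pi * real k / real N)\<bar> * \<bar>sin (pi * (real k - 2 * real j) / real N)\<bar>))" for j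
  proof -
    define F where "F i = 2 * (\<bar>sin (\<psi> + pi * real_of_int i / real N)\<bar> *
      \<bar>sin (pi * (real_of_int i - 2 * real j) / real N)\<bar>)" for i
    \<comment> \<open>Moving i by N shifts both sine arguments by multiples of pi. So
      \<open>F\<close> has period N, and for fixed j the index i may be replaced by k = i + j, with
      i - j = k - 2 j.\<close>
    have per: "F (i + int N * l) = F i" for i l
      using abs_sin_add_int_pi[of "\<psi> + pi * real_of_int i / real N" l]
        abs_sin_add_int_pi[of "pi * (real_of_int i - 2 * real j) / real N" l] assms
      by (simp add: F_def field_simps)
    have "\<bar>cos (\<psi> + 2 * pi * real i / real N) - cos (\<psi> + 2 * pi * real j / real N)\<bar> = F (1 * int i
        + int j)" for i
    proof -
      define x y where "x = \<psi> + pi * (real i + real j) / real N" and "y = pi * (real i - real j) / real N"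
      have "\<psi> + 2 * pi * real i / real N = x + y" "\<psi> + 2 * pi * real j / real N = x - y"
        by (simp_all add: x_def y_def add_divide_distrib diff_divide_distrib algebra_simps)
      moreover have "\<bar>cos (x + y) - cos (x - y)\<bar> = 2 * (\<bar>sin x\<bar> * \<bar>sin y\<bar>)"
        by (simp add: cos_add cos_diff abs_mult)
      moreover have "F (1 * int i + int j) = 2 * (\<bar>sin x\<bar> * \<bar>sin y\<bar>)"
        by (simp add: F_def x_def y_def)
      ultimately show ?thesis
        by (simp only:)
    qed
    then show ?thesis
      using sum_periodic_affine[of F N 1 "int j", OF per] by (simp add: F_def)
  qed
  have "vertex_spread N \<psi> = (\<Sum>j<N. \<Sum>i<N.
    \<bar>cos (\<psi> + 2 * pi * real i / real N) - cos (\<psi> + 2 * pi * real j / real N)\<bar>)"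
    unfolding vertex_spread_def by (rule sum.swap)
  also have "\<dots> = (\<Sum>j<N. \<Sum>k<N. 2 * (\<bar>sin (\<psi> + pi * real k / real N)\<bar> * \<bar>sin (pi * (real k - 2 *
      real j) / real N)\<bar>))"
    by (simp only: inner)
  also have "\<dots> = (\<Sum>k<N. \<Sum>j<N. 2 * (\<bar>sin (\<psi> + pi * real k / real N)\<bar> * \<bar>sin (pi * (real k - 2 *
      real j) / real N)\<bar>))"
    by (rule sum.swap)
  finally show ?thesis
    by (simp add: sum_distrib_left)
qed

text \<open>For odd \<open>N\<close> doubling is invertible modulo \<open>N\<close>, so k - 2 j runs
  through all residues as j does. The inner sum is then the same for every k and factors
  out.\<close>

lemma vertex_spread_odd:
  assumes "odd N"
  shows "vertex_spread N \<psi> = 2 * abs_sin_sum N 0 * abs_sin_sum N \<psi>"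
proof -
  have N: "N > 0" using assms by (rule odd_pos)
  define F where "F i = \<bar>sin (pi * real_of_int i / real N)\<bar>" for i
  have per: "F (i + int N * l) = F i" for i l
    using abs_sin_add_int_pi[of "pi * real_of_int i / real N" l] N
    by (simp add: F_def field_simps)
  have "(\<Sum>j<N. \<bar>sin (pi * (real k - 2 * real j) / real N)\<bar>) = abs_sin_sum N 0" for k
    using sum_periodic_affine[of F N "-2" "int k", OF per] assms
    by (simp add: F_def abs_sin_sum_def)
  then show ?thesis
    by (simp add: vertex_spread_eq[OF N] abs_sin_sum_def[of N \<psi>] flip: sum_distrib_right)
qed

lemma sum_lessThan_double:
  fixes f :: "nat \<Rightarrow> 'a::comm_monoid_add"
  shows "sum f {..<2 * h} = (\<Sum>j<h. f (2 * j)) + (\<Sum>j<h. f (2 * j + 1))"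
  by (induction h) (simp_all add: ac_simps)

text \<open>For an even number of vertices k - 2 j keeps the parity of k, so the inner sum depends
  on that parity alone. Even and odd k contribute one product each, the odd one offset by half a
  spacing.\<close>

lemma vertex_spread_even:
  assumes "h > 0"
  shows "vertex_spread (2 * h) \<psi> = 4 * (abs_sin_sum h 0 * abs_sin_sum h \<psi> +
    abs_sin_sum h (pi / (2 * real h)) * abs_sin_sum h (\<psi> + pi / (2 * real h)))"
proof -
  have H: "(\<Sum>j<2*h. \<bar>sin (pi * (real k - 2 * real j) / real (2*h))\<bar>) =
      2 * abs_sin_sum h (pi * real k / (2 * real h))" for k
  proof -
    define F where "F i = \<bar>sin (pi * real k / (2*real h) + pi * real_of_int i / real h)\<bar>" for i
    have per: "F (i + int h * l) = F i" for i l
      using abs_sin_add_int_pi[of "pi * real k / (2*real h) + pi * real_of_int i / real h" l] assms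
      by (simp add: F_def field_simps)
    have per2: "F (i + int (2*h) * l) = F i" for i l
      using per[of i "2*l"] by (simp add: ac_simps)
    have eq: "\<bar>sin (pi * (real k - 2 * real j) / real (2*h))\<bar> = F (-1 * int j + 0)" for j
      using assms by (simp add: F_def field_simps)
    have "(\<Sum>j<2*h. \<bar>sin (pi * (real k - 2 * real j) / real (2*h))\<bar>) = (\<Sum>j<2*h. F (int j))"
      unfolding eq by (rule sum_periodic_affine[OF per2]) simp
    \<comment> \<open>\<open>F\<close> already has period h, so the range of length 2 h covers it
      twice; this is the factor 2 in the claim.\<close>
    also have "\<dots> = (\<Sum>j<h. F (int j)) + (\<Sum>j\<in>{h..<2*h}. F (int j))"
      by (simp add: lessThan_atLeast0 sum.atLeastLessThan_concat)
    also have "(\<Sum>j\<in>{h..<2*h}. F (int j)) = (\<Sum>j<h. F (int j + int h * 1))"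
      using sum.shift_bounds_nat_ivl[of "\<lambda>j. F (int j)" 0 h h] by (simp add: lessThan_atLeast0 mult_2)
    finally show ?thesis
      unfolding per by (simp add: F_def abs_sin_sum_def)
  qed
  have e: "abs_sin_sum h (pi * real (2 * m) / (2 * real h)) = abs_sin_sum h 0" for m
    using abs_sin_sum_shift[of h 0 "int m"] assms by simp
  have o: "abs_sin_sum h (pi * real (2 * m + 1) / (2 * real h)) = abs_sin_sum h (pi / (2 * real h))" for m
    using abs_sin_sum_shift[of h "pi / (2 * real h)" "int m"] assms
    by (simp add: add_divide_distrib distrib_left add.commute)
  have "vertex_spread (2 * h) \<psi> = 4 * (\<Sum>k<2*h. \<bar>sin (\<psi> + pi * real k / real (2*h))\<bar> * abs_sin_sum
      h (pi * real k / (2 * real h)))"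
    using assms by (subst vertex_spread_eq) (simp_all only: H, simp_all add: sum_distrib_left ac_simps)
  also have "\<dots> = 4 * ((\<Sum>m<h. \<bar>sin (\<psi> + pi * real m / real h)\<bar> * abs_sin_sum h 0) +
     (\<Sum>m<h. \<bar>sin (\<psi> + pi / (2 * real h) + pi * real m / real h)\<bar> * abs_sin_sum h (pi / (2 * real h))))"
    unfolding sum_lessThan_double e o by (simp add: add_divide_distrib distrib_left ac_simps)
  finally show ?thesis
    by (simp add: abs_sin_sum_def sum_distrib_left sum_distrib_right ac_simps)
qed

section \<open>The extremal polygon sum\<close>

text \<open>A quarter of the maximum of \<open>vertex_spread N\<close> over all angles, proved in
  \<open>vertex_spread_le\<close> and \<open>vertex_spread_attained\<close>. It is the length
  \<open>L\<close> of the longest \<open>v n\<close>.\<close>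

definition polygon_bound :: "nat \<Rightarrow> real"
  where "polygon_bound N =
    (if even N then sqrt (3 * (cos (pi / real N))\<^sup>2 + 1) / (sin (pi / real N))\<^sup>2
     else cos (pi / (2 * real N)) / (2 * (sin (pi / (2 * real N)))\<^sup>2))"

lemma sin_cos_combine_le: "a * cos y + b * sin y \<le> sqrt (a\<^sup>2 + b\<^sup>2)"
proof (rule real_le_rsqrt)
  \<comment> \<open>Lagrange's identity: the gap in the Cauchy-Schwarz inequality is the square of
    the other combination.\<close>
  have "(a * cos y + b * sin y)\<^sup>2 + (a * sin y - b * cos y)\<^sup>2 = (a\<^sup>2 + b\<^sup>2) * ((sin y)\<^sup>2 + (cos y)\<^sup>2)"
    by algebra
  then show "(a * cos y + b * sin y)\<^sup>2 \<le> a\<^sup>2 + b\<^sup>2"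
    by (metis le_add_same_cancel1 mult.right_neutral sin_cos_squared_add zero_le_power2)
qed

lemma periodic_representative:
  assumes "p > (0::real)"
  obtains k :: int and y where "x = y + p * of_int k" "0 \<le> y" "y < p"
proof
  show "x = (x - p * of_int \<lfloor>x / p\<rfloor>) + p * of_int \<lfloor>x / p\<rfloor>" by simp
  show "0 \<le> x - p * of_int \<lfloor>x / p\<rfloor>" "x - p * of_int \<lfloor>x / p\<rfloor> < p"
    using assms floor_divide_lower[of p x] floor_divide_upper[of p x]
    by (auto simp: algebra_simps)
qed

text \<open>The numerator becomes the amplitude of the sinusoid in
  \<open>vertex_spread_even_eq\<close>, the root of the sum of squares of its two
  coefficients.\<close>

lemma polygon_bound_even:
  assumes "h > 0"
  shows "polygon_bound (2 * h) = sqrt ((1 + (cos (pi / (2 * real h)))\<^sup>2)\<^sup>2 +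
    (cos (pi / (2 * real h)) * sin (pi / (2 * real h)))\<^sup>2) / (sin (pi / (2 * real h)))\<^sup>2"
proof -
  have "(1 + c\<^sup>2)\<^sup>2 + (c * s)\<^sup>2 = 3 * c\<^sup>2 + 1" if "s\<^sup>2 + c\<^sup>2 = 1" for s c :: real
    using that by algebra
  from this[OF sin_cos_squared_add] show ?thesis
    by (simp add: polygon_bound_def)
qed

text \<open>On this half sector both y and y + pi / (2 h) stay in [0, pi / h], so
  \<open>abs_sin_sum_eq\<close> evaluates all four factors.\<close>

lemma vertex_spread_even_eq:
  assumes h: "h \<ge> 2" and y: "0 \<le> y" "y \<le> pi / (2 * real h)"
  defines "c \<equiv> cos (pi / (2 * real h))" and "s \<equiv> sin (pi / (2 * real h))"
  shows "vertex_spread (2 * h) y = 4 * ((1 + c\<^sup>2) * cos y + c * s * sin y) / s\<^sup>2"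
proof -
  have h0: "h > 0" using h by simp
  define a where "a = pi / (2 * real h)"
  have a: "a > 0" "2 * a = pi / real h" "a < pi"
    using h pi_gt_zero by (auto simp: a_def field_simps)
  then have s: "s > 0" unfolding s_def a_def[symmetric] by (intro sin_gt_zero)
  have 1: "abs_sin_sum h 0 = c / s"
    using abs_sin_sum_eq[of 0 h] h0 by (simp add: c_def s_def)
  have 2: "abs_sin_sum h a = 1 / s"
    using abs_sin_sum_eq[of a h] h0 a by (simp add: c_def s_def a_def)
  have 3: "abs_sin_sum h y = cos (y - a) / s"
    using abs_sin_sum_eq[of y h] h0 a y by (simp add: c_def s_def a_def)
  have 4: "abs_sin_sum h (y + a) = cos y / s"
    using abs_sin_sum_eq[of "y + a" h] h0 a y by (simp add: c_def s_def a_def)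
  have "vertex_spread (2 * h) y = 4 * (c / s * (cos (y - a) / s) + 1 / s * (cos y / s))"
    using vertex_spread_even[OF h0, of y] 1 2 3 4 by (simp add: a_def)
  also have "cos (y - a) = cos y * c + sin y * s"
    by (simp add: cos_diff a_def c_def s_def)
  also have "4 * (c / s * ((cos y * c + sin y * s) / s) + 1 / s * (cos y / s)) = 4 * ((1 + c\<^sup>2) *
      cos y + c * s * sin y) / s\<^sup>2"
    using s by (simp add: field_simps power2_eq_square)
  finally show ?thesis .
qed

text \<open>The closed form on a sector is symmetric about its midpoint. In the second factor y + a
  has left the sector and is first moved back by one spacing 2 a.\<close>

lemma vertex_spread_even_reflect:
  assumes h: "h > 0" and y: "pi / (2 * real h) \<le> y" "y \<le> pi / real h"
  shows "vertex_spread (2 * h) y = vertex_spread (2 * h) (pi / real h - y)"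
proof -
  define a where "a = pi / (2 * real h)"
  have a: "2 * a = pi / real h" by (simp add: a_def)
  have "abs_sin_sum h y = abs_sin_sum h (2 * a - y)"
    using abs_sin_sum_eq[of y h] abs_sin_sum_eq[of "2 * a - y" h] cos_minus[of "y - a"] h y a
    by (simp add: a_def)
  moreover have "abs_sin_sum h (y + a) = abs_sin_sum h (2 * a - y + a)"
    using abs_sin_sum_eq[of "y - a" h] abs_sin_sum_eq[of "2 * a - y + a" h] cos_minus[of "y - 2 * a"] h y a
      abs_sin_sum_shift[of h "y - a" 1]
    by (simp add: a_def add.commute)
  ultimately show ?thesis
    using vertex_spread_even[OF h] a by (simp add: a_def)
qed

text \<open>Periodicity brings the angle into one sector. For even \<open>N\<close> a reflection
  then reaches the half sector where a single sinusoid is bounded by its amplitude; for odd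
  \<open>N\<close> the bound is just cos (y - b) at most 1.\<close>

lemma vertex_spread_le:
  assumes "N \<ge> 3"
  shows "vertex_spread N \<psi> \<le> 4 * polygon_bound N"
proof (cases "even N")
  case True
  then obtain h where N: "N = 2 * h" by blast
  then have h: "h \<ge> 2" using assms by simp
  obtain k y where k: "\<psi> = y + pi / real h * of_int k" and y: "0 \<le> y" "y < pi / real h"
    using periodic_representative[of "pi / real h" \<psi>] h
    by (metis divide_pos_pos of_nat_0_less_iff pi_gt_zero pos2 less_le_trans)
  have "vertex_spread N \<psi> = vertex_spread N y"
  proof -
    have "abs_sin_sum h \<psi> = abs_sin_sum h y"
      using abs_sin_sum_shift[of h y k] by (simp add: k)
    moreover have "abs_sin_sum h (\<psi> + pi / (2 * real h)) = abs_sin_sum h (y + pi / (2 * real h))"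
      using abs_sin_sum_shift[of h "y + pi / (2 * real h)" k] by (simp add: k ac_simps)
    ultimately show ?thesis
      using h unfolding N by (simp add: vertex_spread_even)
  qed
  moreover obtain z where "vertex_spread N y = vertex_spread N z" "0 \<le> z" "z \<le> pi / (2 * real h)"
  proof (cases "y \<le> pi / (2 * real h)")
    case False
    have "2 * (pi / (2 * real h)) = pi / real h" by simp
    with False y have "pi / real h - y \<le> pi / (2 * real h)" by linarith
    then show ?thesis
      using that[of "pi / real h - y"] vertex_spread_even_reflect[of h y] False y h by (simp add: N)
  qed (use y that in blast)
  ultimately have "vertex_spread N \<psi> =
      4 * ((1 + (cos (pi / (2 * real h)))\<^sup>2) * cos z +
        cos (pi / (2 * real h)) * sin (pi / (2 * real h)) * sin z) / (sin (pi / (2 * real h)))\<^sup>2"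
    using vertex_spread_even_eq[OF h] by (simp add: N)
  also have "\<dots> \<le> 4 * polygon_bound N"
    using h sin_cos_combine_le[of "1 + (cos (pi / (2 * real h)))\<^sup>2" z]
    unfolding N by (simp add: polygon_bound_even divide_right_mono del: distrib_left_numeral)
  finally show ?thesis .
next
  case False
  define b where "b = pi / (2 * real N)"
  obtain k y where k: "\<psi> = y + pi / real N * of_int k" and y: "0 \<le> y" "y < pi / real N"
    using periodic_representative[of "pi / real N" \<psi>] assms
    by (metis divide_pos_pos of_nat_0_less_iff pi_gt_zero zero_less_numeral less_le_trans)
  have b: "0 < b" "b < pi" "b < pi / 2"
    using assms pi_gt_zero by (auto simp: b_def field_simps)
  have sb: "sin b > 0" using b by (intro sin_gt_zero)
  have cb: "cos b > 0" using b by (intro cos_gt_zero) auto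
  have "vertex_spread N \<psi> = 2 * (cos b / sin b) * (cos (y - b) / sin b)"
    using abs_sin_sum_shift[of N y k] abs_sin_sum_eq[of 0 N] abs_sin_sum_eq[of y N] assms y
    by (simp add: vertex_spread_odd[OF False] k b_def ac_simps)
  also have "\<dots> \<le> 2 * (cos b / sin b) * (1 / sin b)"
    using sb cb by (intro mult_left_mono divide_right_mono) auto
  finally show ?thesis
    using False by (simp add: polygon_bound_def b_def power2_eq_square)
qed

lemma vertex_spread_attained:
  assumes "N \<ge> 3"
  shows "\<exists>\<psi>. vertex_spread N \<psi> = 4 * polygon_bound N"
proof (cases "even N")
  case True
  then obtain h where N: "N = 2 * h" by blast
  then have h: "h \<ge> 2" using assms by simp
  define a where "a = pi / (2 * real h)"
  define p q where "p = 1 + (cos a)\<^sup>2" and "q = cos a * sin a"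
  define y where "y = arctan (q / p)"
  have a: "0 < a" "a < pi / 2"
    using h pi_gt_zero by (auto simp: a_def field_simps)
  have c: "cos a > 0" and s: "sin a > 0"
    using a by (auto intro!: cos_gt_zero sin_gt_zero)
  have p: "p > 0" and q: "q > 0"
    using c s by (auto simp: p_def q_def add_pos_pos)
  \<comment> \<open>The sinusoid peaks where tan y = q / p. The formula for the spread holds only up
    to \<open>a\<close>, so the peak must be shown to lie there; the inequality amounts to c^2 at
    most 1 + c^2 for c = cos a.\<close>
  have "q / p \<le> tan a"
    using c s p unfolding tan_def
    by (simp add: p_def q_def field_simps power2_eq_square)
  then have "y \<le> a"
    using arctan_monotone'[of "q / p" "tan a"] a by (simp add: y_def arctan_tan)
  moreover have "0 \<le> y" using p q by (simp add: y_def)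
  moreover have "sqrt (p\<^sup>2 + q\<^sup>2) = p * sqrt (1 + (q / p)\<^sup>2)"
  proof -
    have "p\<^sup>2 + q\<^sup>2 = p\<^sup>2 * (1 + (q / p)\<^sup>2)"
      using p by (simp add: power_divide distrib_left)
    then show ?thesis
      using p by (simp only: real_sqrt_mult) simp
  qed
  then have "cos y = p / sqrt (p\<^sup>2 + q\<^sup>2)" "sin y = q / sqrt (p\<^sup>2 + q\<^sup>2)"
    using p by (simp_all add: y_def cos_arctan sin_arctan)
  then have "p * cos y + q * sin y = sqrt (p\<^sup>2 + q\<^sup>2)"
    by (simp add: add_divide_distrib[symmetric] power2_eq_square[symmetric] real_div_sqrt)
  ultimately have "vertex_spread N y = 4 * polygon_bound N"
    using vertex_spread_even_eq[OF h, of y] h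
    by (simp add: N polygon_bound_even a_def p_def q_def)
  then show ?thesis ..
next
  case False
  \<comment> \<open>In the odd case the maximiser is the midpoint of the sector; this places it
    inside the range of \<open>abs_sin_sum_eq\<close>.\<close>
  have "pi / (2 * real N) \<le> pi / real N"
    using assms by (simp add: field_simps)
  then have "vertex_spread N (pi / (2 * real N)) = 4 * polygon_bound N"
    using abs_sin_sum_eq[of 0 N] abs_sin_sum_eq[of "pi / (2 * real N)" N] assms
    by (simp add: vertex_spread_odd[OF False] polygon_bound_def False power2_eq_square)
  then show ?thesis ..
qed

section \<open>Rearrangement\<close>

text \<open>The value \<open>c t\<close> gets a plus sign from t - 1 smaller indices and a minus
  sign from N - t larger ones, which gives 2 t - N - 1. The factor 2 reflects the symmetric roles of
  s and t.\<close>

lemma weighted_sum_eq_sgn_differences: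
  fixes c :: "nat \<Rightarrow> real"
  shows "(\<Sum>s=1..N. \<Sum>t=1..N. sgn (real t - real s) * (c t - c s)) =
    2 * (\<Sum>t=1..N. (2 * real t - real N - 1) * c t)"
proof (induction N)
  case (Suc N)
  have "(\<Sum>s=1..Suc N. \<Sum>t=1..Suc N. sgn (real t - real s) * (c t - c s)) =
     (\<Sum>s=1..N. \<Sum>t=1..N. sgn (real t - real s) * (c t - c s)) + 2 * (\<Sum>s=1..N. c (Suc N) - c s)"
    by (simp add: sum.distrib algebra_simps sum_subtractf sum_negf)
  also have "\<dots> = 2 * (\<Sum>t=1..Suc N. (2 * real t - real (Suc N) - 1) * c t)"
    unfolding Suc by (simp add: sum.distrib sum_subtractf sum_negf algebra_simps sum_distrib_left)
  finally show ?case .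
qed simp

text \<open>A zero total removes the constant part of the weights. With signs in place of weights,
  comparison with absolute differences works term by term, with equality for sorted values.\<close>

lemma weighted_sum_centred:
  fixes c :: "nat \<Rightarrow> real"
  assumes "(\<Sum>t=1..N. c t) = 0"
  shows "4 * (\<Sum>t=1..N. real t * c t) = (\<Sum>s=1..N. \<Sum>t=1..N. sgn (real t - real s) * (c t - c s))"
proof -
  have "(\<Sum>t=1..N. (2 * real t - real N - 1) * c t) =
      2 * (\<Sum>t=1..N. real t * c t) - (real N + 1) * (\<Sum>t=1..N. c t)"
    by (simp add: sum_distrib_left algebra_simps sum_subtractf sum.distrib)
  then show ?thesis
    using assms weighted_sum_eq_sgn_differences[of c N] by simp
qed

lemma exists_sorting_numbering:
  fixes b :: "'m \<Rightarrow> real"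
  assumes "finite M"
  obtains n where "n \<in> numberings M"
    "\<And>s t. 1 \<le> s \<Longrightarrow> s \<le> t \<Longrightarrow> t \<le> card M \<Longrightarrow> b (n s) \<le> b (n t)"
proof -
  obtain xs where xs: "set xs = M" "distinct xs"
    using assms finite_distinct_list by blast
  define ys where "ys = sort_key b xs"
  have ys: "set ys = M" "distinct ys" "sorted (map b ys)" "length ys = card M"
    using xs distinct_card[of xs] by (auto simp: ys_def)
  \<comment> \<open>List positions start at 0 and numberings at 1, hence t - 1;
    \<open>restrict\<close> supplies the extensionality that \<open>numberings\<close>
    demands.\<close>
  define n where "n = restrict (\<lambda>t. ys ! (t - 1)) {1..card M}"
  have "bij_betw ((!) ys) {..<card M} M"
    using bij_betw_nth[OF ys(2) refl refl] by (simp add: ys(1,4))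
  moreover have "bij_betw (\<lambda>t. t - 1) {1..card M} {..<card M}"
    by (rule bij_betw_byWitness[where f' = Suc]) auto
  ultimately have "bij_betw ((!) ys \<circ> (\<lambda>t. t - 1)) {1..card M} M"
    by (rule bij_betw_trans[rotated])
  then have "bij_betw n {1..card M} M"
    by (rule bij_betw_cong[THEN iffD1, rotated]) (simp add: n_def)
  then have "n \<in> numberings M"
    by (simp add: numberings_def n_def)
  moreover have "b (n s) \<le> b (n t)" if "1 \<le> s" "s \<le> t" "t \<le> card M" for s t
  proof -
    have "s - 1 \<le> t - 1" "t - 1 < length ys" using that ys by auto
    then have "map b ys ! (s - 1) \<le> map b ys ! (t - 1)"
      using ys(3) by (intro sorted_nth_mono) auto
    then show ?thesis using that ys by (simp add: n_def)
  qed
  ultimately show thesis by (rule that)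
qed

section \<open>Heights of the labelled vertices along a numbering\<close>

locale polygon_labelling =
  fixes M :: "'m set" and \<theta> :: real and p :: "'m \<Rightarrow> real \<times> real"
  assumes finite_M: "finite M" and card_M: "card M \<ge> 3"
    and bij_p: "bij_betw p M (regular_polygon (card M) \<theta>)"
begin

abbreviation height :: "real \<Rightarrow> 'm \<Rightarrow> real"
  where "height \<phi> m \<equiv> fst (p m) * cos \<phi> + snd (p m) * sin \<phi>"

text \<open>The component of \<open>v n\<close> along the unit vector at angle
  \<open>\<phi>\<close>.\<close>

definition weighted_height :: "(nat \<Rightarrow> 'm) \<Rightarrow> real \<Rightarrow> real"
  where "weighted_height n \<phi> = (\<Sum>t=1..card M. real t * height \<phi> (n t))"

lemma sum_vertices:
  "(\<Sum>m\<in>M. f (p m)) = (\<Sum>k<card M. f (cos (\<theta> + 2 * pi * real k / real (card M)), sin (\<theta> + 2 * pi *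
      real k / real (card M))))"
proof -
  let ?v = "\<lambda>k. (cos (\<theta> + 2 * pi * real k / real (card M)), sin (\<theta> + 2 * pi * real k / real (card M)))"
  \<comment> \<open>The bijection \<open>p\<close> forces the image to have \<open>card M\<close>
    elements, so the parametrisation of the vertices is injective without any trigonometry.\<close>
  have "card (?v ` {..<card M}) = card {..<card M}"
    using bij_betw_same_card[OF bij_p] by (simp add: regular_polygon_def)
  then have "inj_on ?v {..<card M}"
    by (intro eq_card_imp_inj_on) auto
  then have "(\<Sum>k<card M. f (?v k)) = (\<Sum>x\<in>regular_polygon (card M) \<theta>. f x)"
    unfolding regular_polygon_def by (simp add: sum.reindex)
  then show ?thesis
    using sum.reindex_bij_betw[OF bij_p, of f] by simp
qed

lemma sum_height: "(\<Sum>m\<in>M. f (height \<phi> m)) = (\<Sum>k<card M. f (cos (\<theta> - \<phi> + 2 * pi * real k / real (card M))))"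
proof -
  have "(\<Sum>m\<in>M. f (height \<phi> m)) = (\<Sum>k<card M. f (cos ((\<theta> + 2 * pi * real k / real (card M)) - \<phi>)))"
    using sum_vertices[of "\<lambda>v. f (fst v * cos \<phi> + snd v * sin \<phi>)"] by (simp only: cos_diff fst_conv snd_conv)
  then show ?thesis by (simp add: algebra_simps)
qed

lemma sum_height_numbering:
  assumes "n \<in> numberings M"
  shows "(\<Sum>t=1..card M. f (height \<phi> (n t))) = (\<Sum>k<card M. f (cos (\<theta> - \<phi> + 2 * pi * real k / real (card M))))"
  using sum.reindex_bij_betw[of n "{1..card M}" M "\<lambda>m. f (height \<phi> m)"] assms sum_height[of f]
  by (simp add: numberings_def)

lemma sum_height_zero:
  assumes "n \<in> numberings M"
  shows "(\<Sum>t=1..card M. height \<phi> (n t)) = 0"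
  using sum_height_numbering[OF assms, of "\<lambda>x. x"] sum_cos_regular_polygon[of "card M"] card_M by simp

text \<open>The double sum does not see the order of the vertices: the inner and then the outer sum
  are reindexed from positions to vertices. Only the relative angle of polygon and direction
  remains.\<close>

lemma spread_numbering:
  assumes "n \<in> numberings M"
  shows "(\<Sum>s=1..card M. \<Sum>t=1..card M. \<bar>height \<phi> (n t) - height \<phi> (n s)\<bar>) = vertex_spread (card M) (\<theta> - \<phi>)"
  unfolding sum_height_numbering[OF assms, of "\<lambda>x. \<bar>x - y\<bar>" for y]
    sum_height_numbering[OF assms, of "\<lambda>y. \<Sum>k<card M. \<bar>x k - y\<bar>" for x]
  unfolding vertex_spread_def
  by (simp add: abs_minus_commute)

lemma weighted_height_le:
  assumes n: "n \<in> numberings M"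
  shows "weighted_height n \<phi> \<le> polygon_bound (card M)"
proof -
  have "4 * weighted_height n \<phi> \<le> (\<Sum>s=1..card M. \<Sum>t=1..card M. \<bar>height \<phi> (n t) - height \<phi> (n s)\<bar>)"
    unfolding weighted_height_def weighted_sum_centred[OF sum_height_zero[OF n]]
    by (intro sum_mono) (auto simp: sgn_if)
  also have "\<dots> \<le> 4 * polygon_bound (card M)"
    unfolding spread_numbering[OF n] using card_M by (rule vertex_spread_le)
  finally show ?thesis by simp
qed

lemma weighted_height_attained:
  obtains n \<phi> where "n \<in> numberings M" "weighted_height n \<phi> = polygon_bound (card M)"
proof -
  obtain \<psi> where \<psi>: "vertex_spread (card M) \<psi> = 4 * polygon_bound (card M)"
    using vertex_spread_attained[OF card_M] ..
  \<comment> \<open>Chosen so that the relative angle \<open>\<theta> - \<phi>\<close> is the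
    optimal \<open>\<psi>\<close>.\<close>
  define \<phi> where "\<phi> = \<theta> - \<psi>"
  obtain n where n: "n \<in> numberings M"
    and sorted: "\<And>s t. 1 \<le> s \<Longrightarrow> s \<le> t \<Longrightarrow> t \<le> card M \<Longrightarrow> height \<phi> (n s) \<le> height \<phi> (n t)"
    using exists_sorting_numbering[OF finite_M, of "height \<phi>"] by blast
  have "sgn (real t - real s) * (height \<phi> (n t) - height \<phi> (n s)) = \<bar>height \<phi> (n t) - height \<phi> (n s)\<bar>"
    if "s \<in> {1..card M}" "t \<in> {1..card M}" for s t
    using sorted[of s t] sorted[of t s] that by (auto simp: sgn_if)
  then have "4 * weighted_height n \<phi> = (\<Sum>s=1..card M. \<Sum>t=1..card M. \<bar>height \<phi> (n t) - height \<phi> (n s)\<bar>)"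
    unfolding weighted_height_def weighted_sum_centred[OF sum_height_zero[OF n]]
    by (intro sum.cong) auto
  then show thesis
    using that[OF n, of \<phi>] spread_numbering[OF n, of \<phi>] \<psi> by (simp add: \<phi>_def)
qed

end

section \<open>Traces in an orthonormal basis\<close>

abbreviation linear_op :: "('h::chilbert_space \<Rightarrow> 'h) \<Rightarrow> bool"
  where "linear_op \<equiv> Vector_Spaces.linear (*\<^sub>C) (*\<^sub>C)"

lemma linear_opI:
  assumes "\<And>x y. A (x + y) = A x + A y" "\<And>c x. A (c *\<^sub>C x) = c *\<^sub>C A x"
  shows "linear_op A"
  using assms by unfold_locales auto

lemma linear_op_add: "linear_op A \<Longrightarrow> A (x + y) = A x + A y"
  unfolding Vector_Spaces.linear_def by (blast dest: module_hom.add)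

lemma linear_op_scaleC: "linear_op A \<Longrightarrow> A (c *\<^sub>C x) = c *\<^sub>C A x"
  unfolding Vector_Spaces.linear_def by (blast dest: module_hom.scale)

lemma linear_op_sum: "linear_op A \<Longrightarrow> A (\<Sum>i\<in>I. f i) = (\<Sum>i\<in>I. A (f i))"
  using linear_op_scaleC[of A 0 0]
  by (induction I rule: infinite_finite_induct) (auto simp: linear_op_add)

lemma cinner_add_left: "cinner (x + y) z = cinner x z + cinner (y::'h::chilbert_space) z"
  by (metis cinner_commute cinner_add_right complex_cnj_add)

lemma cinner_scaleC_left: "cinner (a *\<^sub>C x) y = cnj a * cinner x (y::'h::chilbert_space)"
  by (metis cinner_commute cinner_scaleC_right complex_cnj_mult)

lemma cinner_zero_right [simp]: "cinner x (0::'h::chilbert_space) = 0"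
  using cinner_add_right[of x 0 0] by simp

lemma cinner_minus_right: "cinner x (- y) = - cinner x (y::'h::chilbert_space)"
  using cinner_add_right[of x y "- y"] by (simp add: add_eq_0_iff)

lemma cinner_diff_right: "cinner x (y - z) = cinner x y - cinner x (z::'h::chilbert_space)"
  using cinner_add_right[of x y "- z"] by (simp add: cinner_minus_right)

lemma cinner_scaleR_right: "cinner x (r *\<^sub>R y) = complex_of_real r * cinner x (y::'h::chilbert_space)"
  by (simp add: scaleR_scaleC cinner_scaleC_right)

lemma cinner_sum_right: "cinner x (\<Sum>i\<in>I. f i) = (\<Sum>i\<in>I. cinner x (f i :: 'h::chilbert_space))"
  by (induction I rule: infinite_finite_induct) (auto simp: cinner_add_right)

lemma orthonormal_basis_expansion:
  fixes B :: "'h::chilbert_space set"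
  assumes B: "orthonormal_basis B" and fin: "finite B"
  shows "x = (\<Sum>e\<in>B. cinner e x *\<^sub>C e)"
proof -
  have "x \<in> complex_vector.span B"
    using B by (simp add: orthonormal_basis_def)
  then obtain u where u: "x = (\<Sum>e\<in>B. u e *\<^sub>C e)"
    using complex_vector.span_finite[OF fin] by auto
  have "cinner e x = u e" if "e \<in> B" for e
  proof -
    have "cinner e x = (\<Sum>f\<in>B. u f * (if e = f then 1 else 0))"
      unfolding u cinner_sum_right cinner_scaleC_right
      using B that by (intro sum.cong) (auto simp: orthonormal_basis_def)
    also have "\<dots> = u e" using fin that by (simp add: if_distrib cong: if_cong)
    finally show ?thesis .
  qed
  then show ?thesis using u by simp
qed

lemma orthonormal_basis_independent:
  fixes B :: "'h::chilbert_space set"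
  assumes B: "orthonormal_basis B"
  shows "complex_vector.independent B"
proof
  assume "complex_vector.dependent B"
  then obtain S u v where S: "finite S" "S \<subseteq> B" and v: "v \<in> S" "u v \<noteq> 0" and 0: "(\<Sum>e\<in>S. u e *\<^sub>C e) = 0"
    unfolding complex_vector.dependent_explicit by blast
  have "0 = cinner v (\<Sum>e\<in>S. u e *\<^sub>C e)" by (simp add: 0)
  also have "\<dots> = (\<Sum>f\<in>S. u f * (if v = f then 1 else 0))"
    unfolding cinner_sum_right cinner_scaleC_right
    using B S v by (intro sum.cong) (auto simp: orthonormal_basis_def subset_iff)
  also have "\<dots> = u v" using S v by (simp add: if_distrib cong: if_cong)
  finally show False using v by simp
qed

text \<open>Expanding \<open>A e\<close> in \<open>C\<close> gives a double sum; after swapping,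
  expanding f in \<open>B\<close> collapses it to the sum over \<open>C\<close>.\<close>

lemma sum_cinner_basis_independent:
  fixes A :: "'h::chilbert_space \<Rightarrow> 'h"
  assumes B: "orthonormal_basis B" "finite B" and C: "orthonormal_basis C" "finite C" and A: "linear_op A"
  shows "(\<Sum>e\<in>B. cinner e (A e)) = (\<Sum>f\<in>C. cinner f (A f))"
proof -
  have "(\<Sum>e\<in>B. cinner e (A e)) = (\<Sum>e\<in>B. \<Sum>f\<in>C. cinner e f * cinner f (A e))"
  proof (rule sum.cong)
    fix e
    show "cinner e (A e) = (\<Sum>f\<in>C. cinner e f * cinner f (A e))"
      by (subst orthonormal_basis_expansion[OF C, of "A e"])
        (simp add: cinner_sum_right cinner_scaleC_right mult.commute)
  qed simp
  also have "\<dots> = (\<Sum>f\<in>C. \<Sum>e\<in>B. cinner e f * cinner f (A e))"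
    by (rule sum.swap)
  also have "\<dots> = (\<Sum>f\<in>C. cinner f (A f))"
  proof (rule sum.cong)
    fix f
    show "(\<Sum>e\<in>B. cinner e f * cinner f (A e)) = cinner f (A f)"
      by (subst (3) orthonormal_basis_expansion[OF B, of f])
        (simp add: linear_op_sum[OF A] linear_op_scaleC[OF A] cinner_sum_right cinner_scaleC_right)
  qed simp
  finally show ?thesis .
qed

text \<open>The basis picked by \<open>SOME\<close> could a priori be infinite. Being independent
  inside the span of the finite \<open>B\<close> it is finite, so basis independence
  applies.\<close>

lemma op_trace_eq:
  fixes A :: "'h::chilbert_space \<Rightarrow> 'h"
  assumes B: "orthonormal_basis B" "finite B" and A: "linear_op A"
  shows "op_trace A = (\<Sum>e\<in>B. cinner e (A e))"
proof -
  define C :: "'h set" where "C = (SOME B. orthonormal_basis B)"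
  have C: "orthonormal_basis C"
    unfolding C_def using B(1) by (rule someI)
  have "C \<subseteq> complex_vector.span B"
    using B by (simp add: orthonormal_basis_def)
  then have "finite C"
    using complex_vector.independent_span_bound[OF B(2) orthonormal_basis_independent[OF C]] by simp
  from sum_cinner_basis_independent[OF C this B A] show ?thesis
    by (simp add: op_trace_def C_def)
qed

section \<open>Qubit operators\<close>

locale qubit_basis =
  fixes e0 e1 :: "'h::chilbert_space"
  assumes ne: "e0 \<noteq> e1" and basis: "orthonormal_basis {e0, e1}"
begin

lemma cinner_basis [simp]:
  "cinner e0 e0 = 1" "cinner e0 e1 = 0" "cinner e1 e0 = 0" "cinner e1 e1 = 1"
  using basis ne by (auto simp: orthonormal_basis_def)

lemma basis_expansion: "v = cinner e0 v *\<^sub>C e0 + cinner e1 v *\<^sub>C e1"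
  using orthonormal_basis_expansion[OF basis, of v] ne by simp

lemma op_trace_qubit: "linear_op A \<Longrightarrow> op_trace A = cinner e0 (A e0) + cinner e1 (A e1)"
  using op_trace_eq[OF basis, of A] ne by simp

lemma linear_bloch: "linear_op (bloch_operator e0 e1 r)"
  by (rule linear_opI; cases r)
    (auto simp: bloch_operator_def pauli_x_def pauli_z_def scaleR_scaleC cinner_add_right cinner_scaleC_right
      scaleC_scaleC complex_vector.scale_left_distrib complex_vector.scale_right_distrib
      complex_vector.scale_right_diff_distrib complex_vector.scale_left_diff_distrib algebra_simps
          add_divide_distrib)

section \<open>Bloch components and positivity of operators\<close>

definition tr :: "('h \<Rightarrow> 'h) \<Rightarrow> real"
  where "tr A = Re (cinner e0 (A e0) + cinner e1 (A e1))"

text \<open>Like \<open>tr_z\<close> below, the real part of the trace of A composed with the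
  corresponding Pauli operator.\<close>

definition tr_x :: "('h \<Rightarrow> 'h) \<Rightarrow> real"
  where "tr_x A = Re (cinner e0 (A e1) + cinner e1 (A e0))"

definition tr_z :: "('h \<Rightarrow> 'h) \<Rightarrow> real"
  where "tr_z A = Re (cinner e0 (A e0) - cinner e1 (A e1))"

lemma trace_scaled_bloch:
  assumes "linear_op A"
  shows "Re (op_trace ((\<lambda>v. c *\<^sub>R bloch_operator e0 e1 r v) \<circ> A)) =
    c / 2 * (tr A + fst r * tr_x A + snd r * tr_z A)"
proof -
  have "linear_op ((\<lambda>v. c *\<^sub>R bloch_operator e0 e1 r v) \<circ> A)"
    using assms linear_bloch
    by (intro linear_opI) (simp_all add: linear_op_add linear_op_scaleC scaleR_add_right
        scaleR_scaleC scaleC_scaleC mult.commute)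
  then show ?thesis
    by (cases r) (simp add: op_trace_qubit tr_def tr_x_def tr_z_def bloch_operator_def pauli_x_def pauli_z_def
      cinner_add_right cinner_diff_right cinner_scaleR_right cinner_scaleC_right
          cinner_minus_right algebra_simps)
qed

text \<open>Bloch angles are measured from the \<open>\<sigma>\<^sub>x\<close> axis, hence the half angle of \<open>pi / 2 - \<phi>\<close>.\<close>

definition unit_vector :: "real \<Rightarrow> 'h"
  where "unit_vector \<phi> = complex_of_real (cos (pi / 4 - \<phi> / 2)) *\<^sub>C e0 + complex_of_real (sin
      (pi / 4 - \<phi> / 2)) *\<^sub>C e1"

lemma cos_sin_half_angle:
  fixes \<phi> :: real
  shows "(cos (pi / 4 - \<phi> / 2))\<^sup>2 = (1 + sin \<phi>) / 2" "(sin (pi / 4 - \<phi> / 2))\<^sup>2 = (1 - sin \<phi>) / 2"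
    "cos (pi / 4 - \<phi> / 2) * sin (pi / 4 - \<phi> / 2) = cos \<phi> / 2"
proof -
  have d: "2 * (pi / 4 - \<phi> / 2) = pi / 2 - \<phi>" by simp
  have "cos (pi / 2 - \<phi>) = sin \<phi>" "sin (pi / 2 - \<phi>) = cos \<phi>"
    by (simp_all add: cos_diff sin_diff)
  then show "(cos (pi / 4 - \<phi> / 2))\<^sup>2 = (1 + sin \<phi>) / 2" "(sin (pi / 4 - \<phi> / 2))\<^sup>2 = (1 - sin \<phi>) / 2"
    "cos (pi / 4 - \<phi> / 2) * sin (pi / 4 - \<phi> / 2) = cos \<phi> / 2"
    using cos_double_cos[of "pi / 4 - \<phi> / 2"] cos_double_sin[of "pi / 4 - \<phi> / 2"]
      sin_double[of "pi / 4 - \<phi> / 2"] unfolding d by (simp_all add: ac_simps)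
qed

text \<open>The left side is twice the expectation of A at
  \<open>unit_vector \<phi>\<close>.\<close>

lemma positive_trace_bound:
  assumes A: "A \<in> positive_operators"
  shows "tr A + cos \<phi> * tr_x A + sin \<phi> * tr_z A \<ge> 0"
proof -
  let ?c = "cos (pi / 4 - \<phi> / 2)" and ?s = "sin (pi / 4 - \<phi> / 2)"
  have lin: "linear_op A" using A by (simp add: positive_operators_def)
  have "0 \<le> Re (cinner (unit_vector \<phi>) (A (unit_vector \<phi>)))"
    using A by (simp add: positive_operators_def)
  also have "\<dots> = ?c\<^sup>2 * Re (cinner e0 (A e0)) + ?s\<^sup>2 * Re (cinner e1 (A e1)) + (?c * ?s) * tr_x A"
    by (simp add: unit_vector_def linear_op_add[OF lin] linear_op_scaleC[OF lin] cinner_add_left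
        cinner_add_right
      cinner_scaleC_left cinner_scaleC_right tr_x_def algebra_simps power2_eq_square)
  also have "\<dots> = (tr A + cos \<phi> * tr_x A + sin \<phi> * tr_z A) / 2"
    unfolding cos_sin_half_angle by (simp add: tr_def tr_z_def field_simps)
  finally show ?thesis by simp
qed

text \<open>A point of the Bloch circle yields a rank-one projection; the half-angle identities
  match the coefficients at \<open>e0\<close> and \<open>e1\<close>. Positivity then reduces to a
  squared modulus.\<close>

lemma bloch_projection:
  "bloch_operator e0 e1 (cos \<phi>, sin \<phi>) v = cinner (unit_vector \<phi>) v *\<^sub>C unit_vector \<phi>"
proof -
  define c s where "c = cos (pi / 4 - \<phi> / 2)" and "s = sin (pi / 4 - \<phi> / 2)"
  have cs: "cos \<phi> = 2 * (c * s)" "sin \<phi> = c\<^sup>2 - s\<^sup>2" "c\<^sup>2 + s\<^sup>2 = 1"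
    using cos_sin_half_angle[of \<phi>] by (simp_all add: c_def s_def field_simps)
  define a b where "a = cinner e0 v" and "b = cinner e1 v"
  have v: "v = a *\<^sub>C e0 + b *\<^sub>C e1" unfolding a_def b_def by (rule basis_expansion)
  have 1: "1 + (c\<^sup>2 - s\<^sup>2) = 2 * c\<^sup>2" "1 - (c\<^sup>2 - s\<^sup>2) = 2 * s\<^sup>2" using cs(3) by linarith+
  have "bloch_operator e0 e1 (cos \<phi>, sin \<phi>) v =
     complex_of_real (1/2) *\<^sub>C ((a *\<^sub>C e0 + b *\<^sub>C e1) + complex_of_real (cos \<phi>) *\<^sub>C (b *\<^sub>C e0 + a *\<^sub>C e1)
       + complex_of_real (sin \<phi>) *\<^sub>C (a *\<^sub>C e0 - b *\<^sub>C e1))"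
    by (simp add: bloch_operator_def pauli_x_def pauli_z_def scaleR_scaleC flip: a_def b_def v)
  also have "\<dots> = (complex_of_real ((1 + (c\<^sup>2 - s\<^sup>2)) / 2) * a + complex_of_real (c * s) * b) *\<^sub>C e0 +
     (complex_of_real ((1 - (c\<^sup>2 - s\<^sup>2)) / 2) * b + complex_of_real (c * s) * a) *\<^sub>C e1"
    unfolding cs(1,2)
    by (simp add: complex_vector.scale_left_distrib complex_vector.scale_right_distrib
      complex_vector.scale_right_diff_distrib complex_vector.scale_left_diff_distrib scaleC_scaleC
          algebra_simps diff_divide_distrib add_divide_distrib)
  also have "\<dots> = (complex_of_real (c\<^sup>2) * a + complex_of_real (c * s) * b) *\<^sub>C e0 +
     (complex_of_real (s\<^sup>2) * b + complex_of_real (c * s) * a) *\<^sub>C e1"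
    unfolding 1 by simp
  also have "\<dots> = cinner (unit_vector \<phi>) v *\<^sub>C unit_vector \<phi>"
    by (simp add: unit_vector_def c_def[symmetric] s_def[symmetric] cinner_add_left
        cinner_scaleC_left a_def[symmetric] b_def[symmetric]
     complex_vector.scale_left_distrib complex_vector.scale_right_distrib scaleC_scaleC
         algebra_simps power2_eq_square)
  finally show ?thesis .
qed

lemma bloch_positive: "bloch_operator e0 e1 (cos \<phi>, sin \<phi>) \<in> positive_operators"
proof -
  have "cinner x (bloch_operator e0 e1 (cos \<phi>, sin \<phi>) x) = complex_of_real ((cmod (cinner
      (unit_vector \<phi>) x))\<^sup>2)" for x
    unfolding bloch_projection cinner_scaleC_right
    by (subst (2) cinner_commute) (rule complex_norm_square[symmetric])
  then show ?thesis
    by (simp add: positive_operators_def linear_bloch)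
qed

lemma tr_bloch: "tr (bloch_operator e0 e1 r) = 1" "tr_x (bloch_operator e0 e1 r) = fst r"
  "tr_z (bloch_operator e0 e1 r) = snd r"
  by (simp_all add: tr_def tr_x_def tr_z_def bloch_operator_def case_prod_beta pauli_x_def pauli_z_def
    cinner_add_right cinner_diff_right cinner_scaleR_right cinner_scaleC_right
    add_divide_distrib diff_divide_distrib)

text \<open>The Pauli terms of antipodal points cancel. This is the completeness of the two-outcome
  measurement used for attainment.\<close>

lemma bloch_opposite: "bloch_operator e0 e1 r v + bloch_operator e0 e1 (- fst r, - snd r) v = v"
  by (cases r) (simp add: bloch_operator_def scaleR_add_right[symmetric] scaleR_half_double)

lemma positive_operator_zero: "(\<lambda>_. 0 :: 'h) \<in> positive_operators"
  by (auto simp: positive_operators_def intro!: linear_opI)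

lemma tr_zero: "tr (\<lambda>_. 0) = 0" "tr_x (\<lambda>_. 0) = 0" "tr_z (\<lambda>_. 0) = 0"
  by (simp_all add: tr_def tr_x_def tr_z_def)

lemma sum_tr_measurement:
  assumes "\<pi> \<in> numbering_measurements M"
  shows "(\<Sum>n\<in>numberings M. tr (\<pi> n)) = 2"
proof -
  have "(\<Sum>n\<in>numberings M. cinner e (\<pi> n e)) = cinner e e" for e
    using assms by (simp add: numbering_measurements_def flip: cinner_sum_right)
  from this[of e0] this[of e1] show ?thesis
    by (simp add: tr_def sum.distrib flip: Re_sum)
qed

end

section \<open>Guesswork of a polygonal ensemble\<close>

locale polygon_ensemble = polygon_labelling M \<theta> p + qubit_basis e0 e1
  for M :: "'m set" and \<theta> p and e0 e1 :: "'h::chilbert_space" +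
  fixes \<rho> :: "'m \<Rightarrow> 'h \<Rightarrow> 'h"
  assumes \<rho>: "\<And>m. m \<in> M \<Longrightarrow> \<rho> m = (\<lambda>v. (1 / real (card M)) *\<^sub>R bloch_operator e0 e1 (p m) v)"
begin

definition moment_x :: "(nat \<Rightarrow> 'm) \<Rightarrow> real"
  where "moment_x n = (\<Sum>t=1..card M. real t * fst (p (n t)))"

definition moment_z :: "(nat \<Rightarrow> 'm) \<Rightarrow> real"
  where "moment_z n = (\<Sum>t=1..card M. real t * snd (p (n t)))"

lemma weighted_height_moment: "weighted_height n \<phi> = moment_x n * cos \<phi> + moment_z n * sin \<phi>"
  by (simp add: weighted_height_def moment_x_def moment_z_def sum_distrib_left sum.distrib algebra_simps)

text \<open>The identity part of the Bloch operators contributes the value (N + 1) / 2 of blind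
  guessing, as the traces of the outcomes sum to 2. All else pairs the moment of a numbering with
  the Bloch components of its operator.\<close>

lemma guesswork_moment:
  assumes \<pi>: "\<pi> \<in> numbering_measurements M"
  shows "guesswork M \<rho> \<pi> = (real (card M) + 1) / 2 +
    (\<Sum>n\<in>numberings M. moment_x n * tr_x (\<pi> n) + moment_z n * tr_z (\<pi> n)) / (2 * real (card M))"
proof -
  let ?N = "real (card M)"
  have N: "?N > 0" using card_M by simp
  have "guesswork M \<rho> \<pi> = (\<Sum>t=1..card M. \<Sum>n\<in>numberings M. 1 / (2 * ?N) *
      (real t * tr (\<pi> n) + (real t * fst (p (n t))) * tr_x (\<pi> n) + (real t * snd (p (n t))) * tr_z (\<pi> n)))"
    unfolding guesswork_def guess_prob_def sum_distrib_left
  proof (intro sum.cong refl)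
    fix t n assume t: "t \<in> {1..card M}" and n: "n \<in> numberings M"
    have "n t \<in> M" using t n by (auto simp: numberings_def dest: bij_betwE)
    moreover have "linear_op (\<pi> n)"
      using \<pi> n by (simp add: numbering_measurements_def positive_operators_def)
    ultimately show "real t * Re (op_trace (\<rho> (n t) \<circ> \<pi> n)) = 1 / (2 * ?N) *
      (real t * tr (\<pi> n) + (real t * fst (p (n t))) * tr_x (\<pi> n) + (real t * snd (p (n t))) * tr_z (\<pi> n))"
      using N by (simp add: \<rho> trace_scaled_bloch field_simps)
  qed
  also have "\<dots> = (\<Sum>n\<in>numberings M. 1 / (2 * ?N) * ((\<Sum>t=1..card M. real t) * tr (\<pi> n) + (moment_x
      n * tr_x (\<pi> n) + moment_z n * tr_z (\<pi> n))))"
    unfolding moment_x_def moment_z_def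
    by (subst sum.swap) (simp only: sum_distrib_left[symmetric] sum_distrib_right[symmetric]
        sum.distrib add.assoc)
  also have "\<dots> = 1 / (2 * ?N) * ((\<Sum>t=1..card M. real t) * 2 + (\<Sum>n\<in>numberings M. moment_x n * tr_x
      (\<pi> n) + moment_z n * tr_z (\<pi> n)))"
    by (simp only: sum_distrib_left[symmetric] sum.distrib sum_tr_measurement[OF \<pi>])
  also have "(\<Sum>t=1..card M. real t) * 2 = ?N * (?N + 1)"
    using double_gauss_sum_from_Suc_0[of "card M", where 'a = real] by simp
  finally show ?thesis using N by (simp add: field_simps)
qed

lemma moment_trace_ge:
  assumes n: "n \<in> numberings M" and A: "A \<in> positive_operators"
  shows "moment_x n * tr_x A + moment_z n * tr_z A \<ge> - polygon_bound (card M) * tr A"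
proof -
  \<comment> \<open>Polar form with r of either sign; evaluating at both \<open>\<phi>\<close> and
    \<open>\<phi> + pi\<close> bounds |r| by the largest weighted height and |q| by the
    trace.\<close>
  obtain r \<phi> where \<phi>: "moment_x n = r * cos \<phi>" "moment_z n = r * sin \<phi>"
    using polar_Ex by blast
  have "weighted_height n \<phi> = r * ((cos \<phi>)\<^sup>2 + (sin \<phi>)\<^sup>2)"
    unfolding weighted_height_moment \<phi> power2_eq_square distrib_left mult.assoc ..
  moreover have "weighted_height n (\<phi> + pi) = - weighted_height n \<phi>"
    by (simp add: weighted_height_moment)
  ultimately have r: "\<bar>r\<bar> \<le> polygon_bound (card M)"
    using weighted_height_le[OF n, of \<phi>] weighted_height_le[OF n, of "\<phi> + pi"] by simp
  define q where "q = cos \<phi> * tr_x A + sin \<phi> * tr_z A"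
  have q: "\<bar>q\<bar> \<le> tr A"
    using positive_trace_bound[OF A, of \<phi>] positive_trace_bound[OF A, of "\<phi> + pi"]
    by (simp add: q_def)
  have "\<bar>r * q\<bar> \<le> polygon_bound (card M) * tr A"
    unfolding abs_mult using r q by (intro mult_mono) auto
  moreover have "moment_x n * tr_x A + moment_z n * tr_z A = r * q"
    by (simp add: \<phi> q_def algebra_simps)
  ultimately show ?thesis by (simp add: abs_le_iff)
qed

lemma guesswork_ge:
  assumes \<pi>: "\<pi> \<in> numbering_measurements M"
  shows "guesswork M \<rho> \<pi> \<ge> (real (card M) + 1) / 2 - polygon_bound (card M) / real (card M)"
proof -
  have "- polygon_bound (card M) * 2 = (\<Sum>n\<in>numberings M. - polygon_bound (card M) * tr (\<pi> n))"
    unfolding sum_distrib_left[symmetric] sum_tr_measurement[OF \<pi>] ..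
  also have "\<dots> \<le> (\<Sum>n\<in>numberings M. moment_x n * tr_x (\<pi> n) + moment_z n * tr_z (\<pi> n))"
    using \<pi> by (intro sum_mono moment_trace_ge) (auto simp: numbering_measurements_def)
  finally have "(- polygon_bound (card M) * 2) / (2 * real (card M)) \<le>
      (\<Sum>n\<in>numberings M. moment_x n * tr_x (\<pi> n) + moment_z n * tr_z (\<pi> n)) / (2 * real (card M))"
    by (rule divide_right_mono) simp
  then show ?thesis
    unfolding guesswork_moment[OF \<pi>] by simp
qed

section \<open>Reversed numberings and the optimal measurement\<close>

definition reversed :: "(nat \<Rightarrow> 'm) \<Rightarrow> nat \<Rightarrow> 'm"
  where "reversed n = restrict (\<lambda>t. n (card M + 1 - t)) {1..card M}"

lemma reversed_numbering:
  assumes "n \<in> numberings M"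
  shows "reversed n \<in> numberings M"
proof -
  have "bij_betw (\<lambda>t. card M + 1 - t) {1..card M} {1..card M}"
    by (rule bij_betw_byWitness[where f' = "\<lambda>t. card M + 1 - t"]) auto
  then have "bij_betw (n \<circ> (\<lambda>t. card M + 1 - t)) {1..card M} M"
    using assms by (auto simp: numberings_def intro: bij_betw_trans)
  then have "bij_betw (reversed n) {1..card M} M"
    by (rule bij_betw_cong[THEN iffD1, rotated]) (simp add: reversed_def)
  then show ?thesis by (simp add: numberings_def reversed_def)
qed

text \<open>The first and last positions are exchanged and differ. The two outcomes of the optimal
  measurement are thus distinct terms of the sum.\<close>

lemma reversed_neq:
  assumes "n \<in> numberings M"
  shows "reversed n \<noteq> n"
proof
  assume "reversed n = n"
  then have "n (card M) = n 1"
    using card_M by (metis (no_types, lifting) reversed_def restrict_apply' add_diff_cancel_right'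
        atLeastAtMost_iff le_trans one_le_numeral order_refl)
  moreover have "inj_on n {1..card M}"
    using assms by (simp add: numberings_def bij_betw_def)
  ultimately have "card M = 1"
    using card_M by (auto dest: inj_onD)
  then show False using card_M by simp
qed

text \<open>Reversal turns the weight t into N + 1 - t, and the constant part drops out because the
  heights sum to zero.\<close>

lemma weighted_height_reversed:
  assumes n: "n \<in> numberings M"
  shows "weighted_height (reversed n) \<phi> = - weighted_height n \<phi>"
proof -
  have "weighted_height (reversed n) \<phi> = (\<Sum>t=1..card M. real t * height \<phi> (n (card M + 1 - t)))"
    unfolding weighted_height_def by (rule sum.cong) (simp_all add: reversed_def)
  also have "\<dots> = (\<Sum>t=1..card M. real (card M + 1 - t) * height \<phi> (n t))"
    by (subst sum.atLeastAtMost_rev) (auto intro!: sum.cong)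
  also have "\<dots> = (\<Sum>t=1..card M. (real (card M) + 1) * height \<phi> (n t) - real t * height \<phi> (n t))"
    by (rule sum.cong) (auto simp: of_nat_diff algebra_simps)
  also have "\<dots> = - weighted_height n \<phi>"
    unfolding sum_subtractf sum_distrib_left[symmetric] sum_height_zero[OF n] weighted_height_def by simp
  finally show ?thesis .
qed

text \<open>Only two outcomes are used: a numbering of largest moment and its reversal, whose moments
  are opposite.\<close>

lemma guesswork_attained:
  obtains \<pi> where "\<pi> \<in> numbering_measurements M"
    "guesswork M \<rho> \<pi> = (real (card M) + 1) / 2 - polygon_bound (card M) / real (card M)"
proof -
  obtain n \<phi> where n: "n \<in> numberings M" and w: "weighted_height n \<phi> = polygon_bound (card M)"
    by (rule weighted_height_attained)
  note ne = reversed_neq[OF n] and rn = reversed_numbering[OF n]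
  \<comment> \<open>The outcome \<open>n\<close> gets the projection opposite to \<open>v n\<close>,
    so that its moment term is as negative as possible; its reversal gets the complementary
    one.\<close>
  define \<pi> where "\<pi> k = (if k = n then bloch_operator e0 e1 (cos (\<phi> + pi), sin (\<phi> + pi))
    else if k = reversed n then bloch_operator e0 e1 (cos \<phi>, sin \<phi>) else (\<lambda>_. 0))" for k
  have fin: "finite (numberings M)"
    by (rule finite_subset[OF _ finite_PiE[of "{1..card M}" "\<lambda>_. M"]])
      (use finite_M in \<open>auto simp: numberings_def PiE_def dest: bij_betwE\<close>)
  \<comment> \<open>Stated for a general target type, as it is applied both to vectors
    (completeness) and to reals (the moment sum).\<close>
  have two: "(\<Sum>k\<in>numberings M. f k) = f n + f (reversed n)"
    if "\<And>k. k \<noteq> n \<Longrightarrow> k \<noteq> reversed n \<Longrightarrow> f k = 0" for f :: "(nat \<Rightarrow> 'm) \<Rightarrow> 'b::comm_monoid_add"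
  proof -
    have "(\<Sum>k\<in>numberings M. f k) = (\<Sum>k\<in>{n, reversed n}. f k)"
      using n rn that fin by (intro sum.mono_neutral_right) auto
    then show ?thesis using ne by simp
  qed
  have "\<pi> k \<in> positive_operators" for k
    using bloch_positive[of \<phi>] bloch_positive[of "\<phi> + pi"] positive_operator_zero unfolding \<pi>_def by auto
  moreover have "(\<Sum>k\<in>numberings M. \<pi> k x) = x" for x
    using two[of "\<lambda>k. \<pi> k x"] ne bloch_opposite[of "(cos \<phi>, sin \<phi>)" x] by (simp add: \<pi>_def add.commute)
  ultimately have \<pi>: "\<pi> \<in> numbering_measurements M"
    by (simp add: numbering_measurements_def)
  have "(\<Sum>k\<in>numberings M. moment_x k * tr_x (\<pi> k) + moment_z k * tr_z (\<pi> k)) =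
      - weighted_height n \<phi> + weighted_height (reversed n) \<phi>"
    by (subst two) (use ne in \<open>simp_all add: \<pi>_def tr_bloch tr_zero weighted_height_moment\<close>)
  also have "\<dots> = - 2 * polygon_bound (card M)"
    by (simp add: weighted_height_reversed[OF n] w)
  finally show thesis
    using that[OF \<pi>] guesswork_moment[OF \<pi>] by simp
qed

end

theorem corollary2:
  fixes M :: "'m set" and \<rho> :: "'m \<Rightarrow> 'h::chilbert_space \<Rightarrow> 'h"
  assumes "finite M"
    and "complex_vector.dim (UNIV :: 'h set) = 2"
    and "\<rho> \<in> ensembles M"
    and "inj_on \<rho> M"
    and "bloch_regular_polygon M \<rho>"
  shows "(\<exists>\<pi>\<in>numbering_measurements M. guesswork M \<rho> \<pi> = min_guesswork M \<rho>) \<and>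
    min_guesswork M \<rho> = (real (card M) + 1) / 2 - 1 / 2 *
      (if even (card M)
       then 2 * sqrt (3 * (cos (pi / real (card M)))\<^sup>2 + 1)
              / (real (card M) * (sin (pi / real (card M)))\<^sup>2)
       else cos (pi / (2 * real (card M)))
              / (real (card M) * (sin (pi / (2 * real (card M))))\<^sup>2))"
proof -
  obtain e0 e1 \<theta> p where "polygon_ensemble M \<theta> p e0 e1 \<rho>"
    using assms(1,5) unfolding bloch_regular_polygon_def polygon_ensemble_def polygon_labelling_def
      qubit_basis_def polygon_ensemble_axioms_def by blast
  then interpret polygon_ensemble M \<theta> p e0 e1 \<rho> .
  let ?G = "(real (card M) + 1) / 2 - polygon_bound (card M) / real (card M)"
  obtain \<pi> where \<pi>: "\<pi> \<in> numbering_measurements M" "guesswork M \<rho> \<pi> = ?G"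
    by (rule guesswork_attained)
  \<comment> \<open>A lower bound that is itself a value is the minimum, so the same
    \<open>\<pi>\<close> settles attainment and the formula.\<close>
  have "min_guesswork M \<rho> = ?G"
    unfolding min_guesswork_def
    using \<pi> guesswork_ge by (intro cInf_eq_minimum) (auto intro: rev_image_eqI)
  then show ?thesis
    using \<pi> by (auto simp: polygon_bound_def)
qed

end
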